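(* Let $G=(X\cup Y,E)$ be a complete bipartite graph and $\mathcal{I}$ a partition of $X$. Let $m\ge 3$ and $1\le k\le m$, let $I_1,I_2\in\mathcal{I}$ be distinct, $i_1\in I_1$, let $i_2,\ldots,i_m\in I_2$ be pairwise distinct and $j_1,\ldots,j_m\in Y$ pairwise distinct. Consider the inequality $$a_{i_1}x_{i_1}+\sum_{p=1}^k a_{j_p}y_{j_p}+\sum_{p=1}^m a_{i_1j_p}z_{i_1j_p}+\sum_{h=2}^m\sum_{p=1}^m a_{i_hj_p}z_{i_hj_p}\ge 0$$ and suppose that its coefficients satisfy all of the following conditions: (i) $a_{i_1j_p}=-1$ for all $p=1,\ldots,m$; (ii) $a_{j_p}=1$ for all $p=1,\ldots,k$; (iii) $a_{i_1}=m-k$; (iv) $a_{i_hj_p}\in\{0,-1\}$ for all $p=1,\ldots,k$ and all $h=2,\ldots,m$; (v) $a_{i_hj_p}\in\{0,1\}$ for all $p=k+1,\ldots,m$ and all $h=2,\ldots,m$; (vi) $\sum_{p=1}^k a_{i_hj_p}+\sum_{p\in R}(a_{i_hj_p}-1)\ge -(m-k)$ for all $h=2,\ldots,m$ and all $R\subseteq\{k+1,\ldots,m\}$. Then the inequality is valid for $P(G,\mathcal{I})$ and supporting (i.e. it is satisfied with equality by at least one point of $P(G,\mathcal{I})$).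
   Context: $G=(X\cup Y,E)$ is a finite complete bipartite graph with disjoint node sets $X,Y$, i.e. $E=\{\{i,j\}: i\in X, j\in Y\}$. $\mathcal{I}$ is a partition of $X$ into non-empty subsets. Vectors in $\mathbb{R}^{X\cup Y\cup E}$ are written $(x,y,z)$. Put $X^{\mathcal{I}}=\{x\in\{0,1\}^X : \sum_{i\in I}x_i\le 1\ \forall I\in\mathcal{I}\}$ and $$P(G,\mathcal{I})=\operatorname{conv}\{(x,y,z)\in\{0,1\}^{X\cup Y\cup E} : x_iy_j=z_{ij}\ \forall\{i,j\}\in E,\ x\in X^{\mathcal{I}}\}.$$ *)

theory Defs
  imports "HOL-Analysis.Analysis" "HOL-Library.Disjoint_Sets"
begin

definition complete_bipartite :: "'v set \<Rightarrow> 'v set \<Rightarrow> 'v set set \<Rightarrow> bool" where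
  "complete_bipartite X Y E \<longleftrightarrow>
     finite X \<and> finite Y \<and> X \<inter> Y = {} \<and> E = {{i, j} |i j. i \<in> X \<and> j \<in> Y}"

text \<open>
  Nodes come from an arbitrary finite type \<open>'v\<close>, edges are two-element sets of nodes. For a set
  \<open>S\<close> of indices, the space of real vectors indexed by \<open>S\<close> is identified with the
  coordinate subspace of the vectors that vanish outside \<open>S\<close>; this makes the library's
  convex hull available for index sets that are not types.
\<close>

type_synonym 'v point = "(real ^ 'v) \<times> (real ^ 'v) \<times> (real ^ ('v set))"

definition binary_vectors :: "'n::finite set \<Rightarrow> (real ^ 'n) set" where
  "binary_vectors S = {v. (\<forall>s\<in>S. v $ s \<in> {0, 1}) \<and> (\<forall>s. s \<notin> S \<longrightarrow> v $ s = 0)}"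

definition multiple_choice_vectors :: "'v::finite set \<Rightarrow> 'v set set \<Rightarrow> (real ^ 'v) set" where
  "multiple_choice_vectors X \<I> = {x \<in> binary_vectors X. \<forall>I\<in>\<I>. (\<Sum>i\<in>I. x $ i) \<le> 1}"

definition bipartite_polytope ::
    "'v::finite set \<Rightarrow> 'v set \<Rightarrow> 'v set set \<Rightarrow> 'v set set \<Rightarrow> 'v point set" where
  "bipartite_polytope X Y E \<I> = convex hull
     {(x, y, z). x \<in> binary_vectors X \<and> y \<in> binary_vectors Y \<and> z \<in> binary_vectors E \<and>
        (\<forall>i\<in>X. \<forall>j\<in>Y. {i, j} \<in> E \<longrightarrow> x $ i * y $ j = z $ {i, j}) \<and>
        x \<in> multiple_choice_vectors X \<I>}"

definition valid_ge :: "('p \<Rightarrow> real) \<Rightarrow> real \<Rightarrow> 'p set \<Rightarrow> bool" where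
  "valid_ge f b P \<longleftrightarrow> (\<forall>v\<in>P. f v \<ge> b)"

text \<open>Only the attainment part of ``supporting''; validity is always asserted separately.\<close>

definition attains_equality :: "('p \<Rightarrow> real) \<Rightarrow> real \<Rightarrow> 'p set \<Rightarrow> bool" where
  "attains_equality f b P \<longleftrightarrow> (\<exists>v\<in>P. f v = b)"

end

theory Submission
  imports Defs
begin

text \<open>
  The left-hand side is linear, so it suffices to bound it at the binary points. There the choice
  constraint on \<open>I2\<close> leaves at most one active \<open>i h\<close> with \<open>h \<ge> 2\<close>, so the double sum collapses to
  a single row of coefficients (or to the zero row). If \<open>x $ i 1 = 0\<close>, the left-hand side is
  nonnegative term by term; if \<open>x $ i 1 = 1\<close>, then (vi) for \<open>R = {p \<in> {k+1..m}. y $ j p = 1}\<close> is what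
  is needed. Equality holds at the origin.
\<close>

text \<open>This is the inequality at a binary point after the double sum has collapsed:
  \<open>x\<close> stands for the coordinate at \<open>i 1\<close>, \<open>y\<close> for the
  coordinates at the \<open>j p\<close>, \<open>d\<close> for the surviving row, \<open>K\<close>
  and \<open>L\<close> for \<open>{1..k}\<close> and \<open>{k+1..m}\<close>, and \<open>r\<close>
  for \<open>m - k\<close>.\<close>

lemma binary_row_nonneg:
  fixes d y :: "'p \<Rightarrow> real" and r x :: real
  assumes "finite K" "finite L"
    and x: "x \<in> {0, 1}"
    and y: "\<And>p. p \<in> K \<union> L \<Longrightarrow> y p \<in> {0, 1}"
    and dK: "\<And>p. p \<in> K \<Longrightarrow> d p \<in> {0, -1}"
    and dL: "\<And>p. p \<in> L \<Longrightarrow> d p \<in> {0, 1}"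
    and bound: "\<And>R. R \<subseteq> L \<Longrightarrow> (\<Sum>p\<in>K. d p) + (\<Sum>p\<in>R. d p - 1) \<ge> - r"
  shows "r * x + (\<Sum>p\<in>K. y p) - x * ((\<Sum>p\<in>K. y p) + (\<Sum>p\<in>L. y p))
           + ((\<Sum>p\<in>K. d p * y p) + (\<Sum>p\<in>L. d p * y p)) \<ge> 0"
proof (cases "x = 0")
  case True
  have "(\<Sum>p\<in>K. y p) + (\<Sum>p\<in>K. d p * y p) = (\<Sum>p\<in>K. y p + d p * y p)"
    by (simp add: sum.distrib)
  \<comment> \<open>Each term is \<open>(1 + d p) * y p\<close>, and \<open>d p\<close> is at least
    -1 on \<open>K\<close>.\<close>
  also have "\<dots> \<ge> 0"
    using y dK by (intro sum_nonneg) fastforce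
  finally have "(\<Sum>p\<in>K. y p) + (\<Sum>p\<in>K. d p * y p) \<ge> 0" .
  moreover have "(\<Sum>p\<in>L. d p * y p) \<ge> 0"
    using y dL by (intro sum_nonneg) fastforce
  ultimately show ?thesis
    using True by simp
next
  case False
  \<comment> \<open>For \<open>x = 1\<close> the two sums of \<open>y\<close> over \<open>K\<close>
    cancel, leaving \<open>r\<close> plus the sum of \<open>d p * y p\<close> over \<open>K\<close>
    plus that of \<open>(d p - 1) * y p\<close> over \<open>L\<close>. The last sum only sees the
    support of \<open>y\<close> in \<open>L\<close>, which is \<open>R\<close>.\<close>
  define R where "R = {p \<in> L. y p = 1}"
  have "(\<Sum>p\<in>L. d p * y p) - (\<Sum>p\<in>L. y p) = (\<Sum>p\<in>L. if y p = 1 then d p - 1 else 0)"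
    unfolding sum_subtractf[symmetric] using y by (intro sum.cong) fastforce+
  also have "\<dots> = (\<Sum>p\<in>R. d p - 1)"
    unfolding R_def using assms(2) by (simp add: sum.inter_filter)
  finally have "(\<Sum>p\<in>L. d p * y p) - (\<Sum>p\<in>L. y p) = (\<Sum>p\<in>R. d p - 1)" .
  \<comment> \<open>Since \<open>d\<close> is nonpositive on \<open>K\<close>, the worst case is
    \<open>y p = 1\<close> throughout \<open>K\<close>.\<close>
  moreover have "(\<Sum>p\<in>K. d p * y p) \<ge> (\<Sum>p\<in>K. d p)"
    using y dK by (intro sum_mono) fastforce
  moreover have "(\<Sum>p\<in>K. d p) + (\<Sum>p\<in>R. d p - 1) \<ge> - r"
    by (rule bound) (auto simp: R_def)
  ultimately show ?thesis
    using False x by simp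
qed

text \<open>A value 1 at \<open>h\<close> uses up the whole bound, so the remaining nonnegative
  values sum to at most 0 and vanish.\<close>

lemma binary_sum_le_one_cases:
  fixes w :: "'h \<Rightarrow> real"
  assumes "finite H" and w: "\<And>h. h \<in> H \<Longrightarrow> w h \<in> {0, 1}" and "(\<Sum>h\<in>H. w h) \<le> 1"
  obtains "\<forall>h\<in>H. w h = 0"
  | h where "h \<in> H" "\<forall>g\<in>H. w g = (if g = h then 1 else 0)"
proof (cases "\<forall>h\<in>H. w h = 0")
  case False
  then obtain h where h: "h \<in> H" "w h = 1"
    using w by auto
  have nonneg: "\<And>g. g \<in> H - {h} \<Longrightarrow> w g \<ge> 0"
    using w by fastforce
  have "(\<Sum>g\<in>H - {h}. w g) \<le> 0"
    using assms(3) h \<open>finite H\<close> by (simp add: sum.remove)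
  then have "(\<Sum>g\<in>H - {h}. w g) = 0"
    using nonneg by (intro order_antisym sum_nonneg)
  then have "\<forall>g\<in>H - {h}. w g = 0"
    using nonneg \<open>finite H\<close> by (subst (asm) sum_nonneg_eq_0_iff) auto
  then show ?thesis
    using h that(2)[of h] by auto
qed (rule that(1))

text \<open>Injectivity turns the sum over indices into a sum over a subset of the block
  \<open>I\<close>; enlarging it to all of \<open>I\<close> only adds nonnegative terms.\<close>

lemma multiple_choice_vectors_sum_le_one:
  fixes x :: "real ^ 'v::finite"
  assumes "x \<in> multiple_choice_vectors X \<I>" "I \<in> \<I>" "i ` H \<subseteq> I" "inj_on i H"
  shows "(\<Sum>h\<in>H. x $ i h) \<le> 1"
proof -
  \<comment> \<open>Outside \<open>X\<close> the coordinates are 0 by the encoding of vectors, so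
    nonnegativity holds at every index.\<close>
  have x: "x $ s \<ge> 0" for s
    using assms(1) by (cases "s \<in> X") (auto simp: multiple_choice_vectors_def binary_vectors_def)
  then have "(\<Sum>s\<in>i ` H. x $ s) \<le> (\<Sum>s\<in>I. x $ s)"
    using assms(3) x by (intro sum_mono2) auto
  also have "\<dots> \<le> 1"
    using assms(1,2) by (simp add: multiple_choice_vectors_def)
  finally show ?thesis
    by (simp add: sum.reindex[OF assms(4)] o_def)
qed

text \<open>The solution set is the preimage of the ray \<open>{b..}\<close> under a linear map,
  hence convex, and the hull is the least convex set containing \<open>S\<close>.\<close>

lemma valid_ge_convex_hull:
  assumes "linear f" "valid_ge f b S"
  shows "valid_ge f b (convex hull S)"
proof -
  have "{v. f v \<ge> b} = f -` {b..}"
    by auto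
  then have "convex {v. f v \<ge> b}"
    using convex_linear_vimage[OF assms(1), of "{b..}"] by simp
  moreover have "S \<subseteq> {v. f v \<ge> b}"
    using assms(2) by (auto simp: valid_ge_def)
  ultimately show ?thesis
    using hull_minimal[of S "{v. f v \<ge> b}" convex] by (auto simp: valid_ge_def)
qed

theorem theorem3p9:
  fixes X Y :: "'v::finite set"
    and E :: "'v set set"
    and \<I> :: "'v set set"
    and I1 I2 :: "'v set"
    and m k :: nat
    and i j :: "nat \<Rightarrow> 'v"
    and a :: "'v \<Rightarrow> real"
    and c :: "'v set \<Rightarrow> real"
  assumes "complete_bipartite X Y E"
    and "partition_on X \<I>"
    and "m \<ge> 3" and "1 \<le> k" and "k \<le> m"
    and "I1 \<in> \<I>" and "I2 \<in> \<I>" and "I1 \<noteq> I2"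
    and "i 1 \<in> I1"
    and "\<forall>h\<in>{2..m}. i h \<in> I2" and "inj_on i {2..m}"
    and "\<forall>p\<in>{1..m}. j p \<in> Y" and "inj_on j {1..m}"
    and i: "\<forall>p\<in>{1..m}. c {i 1, j p} = -1"
    and ii: "\<forall>p\<in>{1..k}. a (j p) = 1"
    and iii: "a (i 1) = real m - real k"
    and iv: "\<forall>p\<in>{1..k}. \<forall>h\<in>{2..m}. c {i h, j p} \<in> {0, -1}"
    and v: "\<forall>p\<in>{k+1..m}. \<forall>h\<in>{2..m}. c {i h, j p} \<in> {0, 1}"
    and vi: "\<forall>h\<in>{2..m}. \<forall>R. R \<subseteq> {k+1..m} \<longrightarrow>
       (\<Sum>p=1..k. c {i h, j p}) + (\<Sum>p\<in>R. (c {i h, j p} - 1)) \<ge> - (real m - real k)"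
  shows "let lhs = (\<lambda>(x, y, z).
             a (i 1) * x $ i 1
             + (\<Sum>p=1..k. a (j p) * y $ j p)
             + (\<Sum>p=1..m. c {i 1, j p} * z $ {i 1, j p})
             + (\<Sum>h=2..m. \<Sum>p=1..m. c {i h, j p} * z $ {i h, j p}))
         in valid_ge lhs 0 (bipartite_polytope X Y E \<I>) \<and>
            attains_equality lhs 0 (bipartite_polytope X Y E \<I>)"
proof -
  define lhs :: "'v point \<Rightarrow> real" where "lhs = (\<lambda>(x, y, z).
             a (i 1) * x $ i 1
             + (\<Sum>p=1..k. a (j p) * y $ j p)
             + (\<Sum>p=1..m. c {i 1, j p} * z $ {i 1, j p})
             + (\<Sum>h=2..m. \<Sum>p=1..m. c {i h, j p} * z $ {i h, j p}))"
  define S where "S = {(x, y, z). x \<in> binary_vectors X \<and> y \<in> binary_vectors Y \<and> z \<in> binary_vectors E \<and>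
        (\<forall>i\<in>X. \<forall>j\<in>Y. {i, j} \<in> E \<longrightarrow> x $ i * y $ j = z $ {i, j}) \<and>
        x \<in> multiple_choice_vectors X \<I>}"
  have P: "bipartite_polytope X Y E \<I> = convex hull S"
    by (simp add: bipartite_polytope_def S_def)
  have E: "{u, v} \<in> E" if "u \<in> X" "v \<in> Y" for u v
    using assms(1) that by (auto simp: complete_bipartite_def)
  have iX: "i h \<in> X" if "h = 1 \<or> h \<in> {2..m}" for h
    using that assms(2,6,7,9,10) unfolding partition_on_def by auto
  have jY: "j p \<in> Y" if "p \<in> {1..m}" for p
    using that assms(12) by blast
  \<comment> \<open>The coefficients change sign pattern after index \<open>k\<close>; for
    \<open>k = m\<close> the second range is empty.\<close>
  have split: "(\<Sum>p=1..m. f p) = (\<Sum>p=1..k. f p) + (\<Sum>p=k+1..m. f p)" for f :: "nat \<Rightarrow> real"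
    using sum.ub_add_nat[of 1 k f "m - k"] \<open>k \<le> m\<close> by simp

  have "linear lhs"
    by (rule linearI)
       (simp_all add: lhs_def case_prod_beta distrib_left sum.distrib sum_distrib_left mult.left_commute)
  moreover have "valid_ge lhs 0 S"
    unfolding valid_ge_def
  proof
    fix v assume "v \<in> S"
    then obtain x y z where v_eq: "v = (x, y, z)"
      and x: "x \<in> binary_vectors X" and y: "y \<in> binary_vectors Y"
      and z: "\<And>u w. u \<in> X \<Longrightarrow> w \<in> Y \<Longrightarrow> z $ {u, w} = x $ u * y $ w"
      and mc: "x \<in> multiple_choice_vectors X \<I>"
      using E unfolding S_def by fastforce
    \<comment> \<open>Substituting the product \<open>x $ i h * y $ j p\<close> for each edge
      coordinate makes \<open>row p\<close> the total coefficient of \<open>y $ j p\<close> in the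
      double sum.\<close>
    define row where "row p = (\<Sum>h=2..m. c {i h, j p} * x $ i h)" for p
    have xi: "x $ i h \<in> {0, 1}" if "h = 1 \<or> h \<in> {2..m}" for h
      using x iX[OF that] by (simp add: binary_vectors_def)
    have yj: "y $ j p \<in> {0, 1}" if "p \<in> {1..m}" for p
      using y jY[OF that] by (simp add: binary_vectors_def)
    have "(\<Sum>h=2..m. x $ i h) \<le> 1"
      using assms(10) by (intro multiple_choice_vectors_sum_le_one[OF mc assms(7) _ assms(11)]) auto
    then consider (zero) "\<forall>h\<in>{2..m}. x $ i h = 0"
      | (one) h where "h \<in> {2..m}" "\<forall>g\<in>{2..m}. x $ i g = (if g = h then 1 else 0)"
      using binary_sum_le_one_cases[of "{2..m}" "\<lambda>h. x $ i h"] xi by blast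
    then have row: "(\<forall>p. row p = 0) \<or> (\<exists>h\<in>{2..m}. \<forall>p. row p = c {i h, j p})"
    proof cases
      case (one h)
      have "row p = (\<Sum>g=2..m. if g = h then c {i g, j p} else 0)" for p
        unfolding row_def using one by (intro sum.cong) auto
      with one have "row p = c {i h, j p}" for p
        by simp
      then show ?thesis
        using one by blast
    qed (auto simp: row_def)

    have "lhs v = (real m - real k) * x $ i 1 + (\<Sum>p=1..k. y $ j p)
                  - x $ i 1 * (\<Sum>p=1..m. y $ j p) + (\<Sum>p=1..m. row p * y $ j p)"
    proof -
      have "(\<Sum>h=2..m. \<Sum>p=1..m. c {i h, j p} * z $ {i h, j p}) = (\<Sum>p=1..m. row p * y $ j p)"
        unfolding row_def sum_distrib_right
        \<comment> \<open>With \<open>p\<close> as the outer index, \<open>y $ j p\<close> is a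
          common factor of the inner sum over \<open>h\<close>.\<close>
        by (subst sum.swap) (intro sum.cong, auto simp: z iX jY)
      moreover have "(\<Sum>p=1..m. c {i 1, j p} * z $ {i 1, j p}) = - (x $ i 1 * (\<Sum>p=1..m. y $ j p))"
        using i by (simp add: z iX jY sum_distrib_left sum_negf)
      moreover have "(\<Sum>p=1..k. a (j p) * y $ j p) = (\<Sum>p=1..k. y $ j p)"
        using ii by (intro sum.cong) auto
      ultimately show ?thesis
        using iii by (simp add: v_eq lhs_def)
    qed
    also have "\<dots> \<ge> 0"
      unfolding split
    proof (rule binary_row_nonneg)
      show "y $ j p \<in> {0, 1}" if "p \<in> {1..k} \<union> {k+1..m}" for p
        using that \<open>k \<le> m\<close> by (intro yj) auto
      \<comment> \<open>The value 0 is allowed by both (iv) and (v), so the zero row meets these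
        sign conditions as well.\<close>
      show "row p \<in> {0, -1}" if "p \<in> {1..k}" for p
        using row iv that by fastforce
      show "row p \<in> {0, 1}" if "p \<in> {k+1..m}" for p
        using row v that by fastforce
      show "(\<Sum>p=1..k. row p) + (\<Sum>p\<in>R. row p - 1) \<ge> - (real m - real k)"
        if "R \<subseteq> {k+1..m}" for R
        using row
      proof
        \<comment> \<open>Condition (vi) speaks only of actual rows \<open>h\<close>. For the zero
          row the left-hand side is minus the cardinality of \<open>R\<close>, so counting
          \<open>{k+1..m}\<close> gives the bound.\<close>
        assume "\<forall>p. row p = 0"
        moreover have "card R \<le> m - k"
          using card_mono[OF _ that] by simp
        ultimately show ?thesis
          using \<open>k \<le> m\<close> by simp
      next
        assume "\<exists>h\<in>{2..m}. \<forall>p. row p = c {i h, j p}"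
        then show ?thesis
          using vi that by auto
      qed
    qed (use xi in auto)
    finally show "lhs v \<ge> 0" .
  qed
  ultimately have "valid_ge lhs 0 (bipartite_polytope X Y E \<I>)"
    unfolding P by (rule valid_ge_convex_hull)
  moreover have "attains_equality lhs 0 (bipartite_polytope X Y E \<I>)"
    unfolding attains_equality_def
  proof
    have "(0, 0, 0) \<in> S"
      by (simp add: S_def binary_vectors_def multiple_choice_vectors_def)
    then show "(0, 0, 0) \<in> bipartite_polytope X Y E \<I>"
      unfolding P by (rule hull_inc)
  qed (simp add: lhs_def)
  ultimately show ?thesis
    by (simp add: lhs_def)
qed

end
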